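(* Let $S$ be a continuous t-conorm weaker than $S_L$, let $\rightharpoonup$ be its residuum, let $d$ be the metric on $[0,1]$ given by $d(x,y)=x\rightharpoonup y$ if $x\le y$ and $d(x,y)=y\rightharpoonup x$ if $x>y$, and let $\mathbf{d}$ be the metric on $[0,1]^2$ given by $\mathbf{d}\big((x_1,x_2),(y_1,y_2)\big)=S\big(d(x_1,y_1),d(x_2,y_2)\big)$. Then $S:([0,1]^2,\mathbf{d})\to([0,1],d)$ and $\rightharpoonup:([0,1]^2,\mathbf{d})\to([0,1],d)$ are continuous functions.
   Context: A continuous t-conorm is a function $S:[0,1]^2\to[0,1]$, continuous for the Euclidean topology, commutative, associative, non-decreasing in each argument, with $S(0,x)=x$ for all $x$. Its residuum is $x\rightharpoonup y=\min\{z\in[0,1]: S(z,x)\ge y\}$ (equivalently $S(z,x)\ge y$ iff $z\ge x\rightharpoonup y$). $S_L(x,y)=\min\{x+y,1\}$, and "$S$ weaker than $S_L$" means $S\le S_L$ pointwise. *)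

theory Defs
  imports "HOL-Analysis.Analysis"
begin

text \<open>Only the values of \<open>S\<close> on the unit square matter; all axioms are relativised to it.\<close>

locale continuous_tconorm =
  fixes S :: "real \<Rightarrow> real \<Rightarrow> real"
  assumes closed: "\<lbrakk>x \<in> {0..1}; y \<in> {0..1}\<rbrakk> \<Longrightarrow> S x y \<in> {0..1}"
    and continuous: "continuous_on ({0..1} \<times> {0..1}) (\<lambda>(x, y). S x y)"
    and commute: "\<lbrakk>x \<in> {0..1}; y \<in> {0..1}\<rbrakk> \<Longrightarrow> S x y = S y x"
    and assoc: "\<lbrakk>x \<in> {0..1}; y \<in> {0..1}; z \<in> {0..1}\<rbrakk> \<Longrightarrow> S (S x y) z = S x (S y z)"
    and mono: "\<lbrakk>x \<in> {0..1}; x' \<in> {0..1}; y \<in> {0..1}; y' \<in> {0..1}; x \<le> x'; y \<le> y'\<rbrakk>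
                 \<Longrightarrow> S x y \<le> S x' y'"
    and zero_left: "x \<in> {0..1} \<Longrightarrow> S 0 x = x"

definition lukasiewicz_tconorm :: "real \<Rightarrow> real \<Rightarrow> real" where
  "lukasiewicz_tconorm x y = min (x + y) 1"

definition weaker_tconorm :: "(real \<Rightarrow> real \<Rightarrow> real) \<Rightarrow> (real \<Rightarrow> real \<Rightarrow> real) \<Rightarrow> bool" where
  "weaker_tconorm S T \<longleftrightarrow> (\<forall>x\<in>{0..1}. \<forall>y\<in>{0..1}. S x y \<le> T x y)"

text \<open>The minimum exists for a continuous t-conorm, by \<open>residuum_exists\<close> below.\<close>

definition residuum :: "(real \<Rightarrow> real \<Rightarrow> real) \<Rightarrow> real \<Rightarrow> real \<Rightarrow> real" where
  "residuum S x y = (LEAST z. z \<in> {0..1} \<and> S z x \<ge> y)"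

text \<open>The library's \<open>Metric_space\<close> demands non-negativity and symmetry on the whole type,
  so both distances are set to \<open>0\<close> outside their carriers \<open>[0,1]\<close> and \<open>[0,1]\<^sup>2\<close>.\<close>

definition tconorm_dist :: "(real \<Rightarrow> real \<Rightarrow> real) \<Rightarrow> real \<Rightarrow> real \<Rightarrow> real" where
  "tconorm_dist S x y =
     (if x \<in> {0..1} \<and> y \<in> {0..1}
      then (if x \<le> y then residuum S x y else residuum S y x) else 0)"

definition tconorm_dist2 :: "(real \<Rightarrow> real \<Rightarrow> real) \<Rightarrow> real \<times> real \<Rightarrow> real \<times> real \<Rightarrow> real" where
  "tconorm_dist2 S p q =
     (if p \<in> {0..1} \<times> {0..1} \<and> q \<in> {0..1} \<times> {0..1}
      then S (tconorm_dist S (fst p) (fst q)) (tconorm_dist S (snd p) (snd q)) else 0)"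

context continuous_tconorm
begin

lemma ge_right: "\<lbrakk>x \<in> {0..1}; y \<in> {0..1}\<rbrakk> \<Longrightarrow> y \<le> S x y"
  using mono[of 0 x y y] zero_left[of y] by auto

lemma ge_left: "\<lbrakk>x \<in> {0..1}; y \<in> {0..1}\<rbrakk> \<Longrightarrow> x \<le> S x y"
  using ge_right[of y x] commute[of x y] by auto

lemma residuum_exists:
  assumes x: "x \<in> {0..1}" and y: "y \<in> {0..1}"
  obtains m where "m \<in> {0..1}" "S m x \<ge> y" "\<And>z. z \<in> {0..1} \<Longrightarrow> S z x \<ge> y \<Longrightarrow> m \<le> z"
proof -
  let ?A = "{z \<in> {0..1}. y \<le> S z x}"
  have "continuous_on {0..1} ((\<lambda>(x, y). S x y) \<circ> (\<lambda>z. (z, x)))"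
    using x by (intro continuous_on_compose continuous_intros)
      (auto intro: continuous_on_subset[OF continuous])
  then have c: "continuous_on {0..1} (\<lambda>z. S z x)" by (simp add: o_def)
  have "closed ({0..1} \<inter> (\<lambda>z. S z x) -` {y..})"
    by (rule continuous_closed_preimage[OF c]) auto
  moreover have "{0..1} \<inter> (\<lambda>z. S z x) -` {y..} = ?A" by auto
  ultimately have "closed ?A" by simp
  moreover have "?A \<subseteq> {0..1}" by auto
  ultimately have "compact ?A"
    by (metis (no_types, lifting) bounded_closed_interval bounded_subset compact_eq_bounded_closed)
  moreover have "1 \<in> ?A" using ge_left[of 1 x] x y by auto
  ultimately obtain m where "m \<in> ?A" "\<forall>z\<in>?A. m \<le> z"
    using compact_attains_inf[of ?A] by blast
  then show thesis using that by auto
qed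

lemma
  assumes x: "x \<in> {0..1}" and y: "y \<in> {0..1}"
  shows residuum_closed: "residuum S x y \<in> {0..1}"
    and residuum_iff: "z \<in> {0..1} \<Longrightarrow> S z x \<ge> y \<longleftrightarrow> z \<ge> residuum S x y"
proof -
  obtain m where m: "m \<in> {0..1}" "S m x \<ge> y" "\<And>z. z \<in> {0..1} \<Longrightarrow> S z x \<ge> y \<Longrightarrow> m \<le> z"
    using residuum_exists[OF x y] by blast
  have r: "residuum S x y = m"
    unfolding residuum_def using m by (intro Least_equality) auto
  show "residuum S x y \<in> {0..1}" using m r by simp
  show "z \<in> {0..1} \<Longrightarrow> S z x \<ge> y \<longleftrightarrow> z \<ge> residuum S x y"
    using m r mono[of m z x x] x by fastforce
qed

lemma tconorm_dist_closed: "tconorm_dist S x y \<in> {0..1}"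
  unfolding tconorm_dist_def using residuum_closed[of x y] residuum_closed[of y x] by auto

lemma tconorm_dist_commute: "tconorm_dist S x y = tconorm_dist S y x"
  unfolding tconorm_dist_def by (auto dest: antisym)

lemma tconorm_dist_le_iff:
  assumes "x \<in> {0..1}" "y \<in> {0..1}" "c \<in> {0..1}"
  shows "tconorm_dist S x y \<le> c \<longleftrightarrow> y \<le> S c x \<and> x \<le> S c y"
  using assms residuum_iff[of x y c] residuum_iff[of y x c] ge_right[of c x] ge_right[of c y]
  unfolding tconorm_dist_def by (smt (verit))

lemma tconorm_dist_triangle:
  assumes "x \<in> {0..1}" "y \<in> {0..1}" "z \<in> {0..1}"
  shows "tconorm_dist S x z \<le> S (tconorm_dist S x y) (tconorm_dist S y z)"
proof -
  let ?a = "tconorm_dist S x y" and ?b = "tconorm_dist S y z"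
  have ab: "?a \<in> {0..1}" "?b \<in> {0..1}" using tconorm_dist_closed assms by auto
  have 1: "y \<le> S ?a x" "x \<le> S ?a y" "z \<le> S ?b y" "y \<le> S ?b z"
    using tconorm_dist_le_iff[of x y ?a] tconorm_dist_le_iff[of y z ?b] ab assms by auto
  have "S ?b y \<le> S ?b (S ?a x)" "S ?a y \<le> S ?a (S ?b z)"
    using 1 ab assms by (auto intro!: mono closed simp del: atLeastAtMost_iff)
  then show ?thesis
    using 1 tconorm_dist_le_iff[of x z "S ?a ?b"] ab assms closed[OF ab] commute[OF ab]
      assoc[of ?a ?b z] assoc[of ?b ?a x] by auto
qed

lemma tconorm_dist_eq_0_iff:
  assumes "x \<in> {0..1}" "y \<in> {0..1}"
  shows "tconorm_dist S x y = 0 \<longleftrightarrow> x = y"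
  using tconorm_dist_le_iff[of x y 0] tconorm_dist_closed[of x y] zero_left assms
  by auto

lemma sum_bound:
  assumes "weaker_tconorm S lukasiewicz_tconorm" "x \<in> {0..1}" "y \<in> {0..1}"
  shows "S x y \<le> x + y"
  using assms unfolding weaker_tconorm_def lukasiewicz_tconorm_def
  by (meson min.boundedE)

text \<open>Both distances are metrics, so the library's metric topology is meaningful for them.\<close>

lemma Metric_space_tconorm_dist:
  assumes "weaker_tconorm S lukasiewicz_tconorm"
  shows "Metric_space {0..1} (tconorm_dist S)"
proof
  show "0 \<le> tconorm_dist S x y" for x y
    using tconorm_dist_closed[of x y] by simp
  show "tconorm_dist S x y = tconorm_dist S y x" for x y
    by (rule tconorm_dist_commute)
  show "tconorm_dist S x y = 0 \<longleftrightarrow> x = y" if "x \<in> {0..1}" "y \<in> {0..1}" for x y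
    using tconorm_dist_eq_0_iff that .
  show "tconorm_dist S x z \<le> tconorm_dist S x y + tconorm_dist S y z"
    if "x \<in> {0..1}" "y \<in> {0..1}" "z \<in> {0..1}" for x y z
    using tconorm_dist_triangle[OF that]
      sum_bound[OF assms tconorm_dist_closed[of x y] tconorm_dist_closed[of y z]] by linarith
qed

lemma Metric_space_tconorm_dist2:
  assumes "weaker_tconorm S lukasiewicz_tconorm"
  shows "Metric_space ({0..1} \<times> {0..1}) (tconorm_dist2 S)"
proof
  note dc = tconorm_dist_closed
  have cl: "tconorm_dist2 S p q \<in> {0..1}" for p q
    unfolding tconorm_dist2_def using closed[OF dc dc] by simp
  show "0 \<le> tconorm_dist2 S p q" for p q
    using cl[of p q] by simp
  show "tconorm_dist2 S p q = tconorm_dist2 S q p" for p q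
    unfolding tconorm_dist2_def by (simp add: conj_commute tconorm_dist_commute)
  show "tconorm_dist2 S p q = 0 \<longleftrightarrow> p = q"
    if "p \<in> {0..1} \<times> {0..1}" "q \<in> {0..1} \<times> {0..1}" for p q
  proof -
    let ?a = "tconorm_dist S (fst p) (fst q)" and ?b = "tconorm_dist S (snd p) (snd q)"
    have "S ?a ?b = 0 \<longleftrightarrow> ?a = 0 \<and> ?b = 0"
      using ge_left[of ?a ?b] ge_right[of ?a ?b]
        dc[of "fst p" "fst q"] dc[of "snd p" "snd q"] zero_left[of 0] by auto
    then show ?thesis
      using that tconorm_dist_eq_0_iff[of "fst p" "fst q"] tconorm_dist_eq_0_iff[of "snd p" "snd q"]
      unfolding tconorm_dist2_def by (auto simp: prod_eq_iff)
  qed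
  show "tconorm_dist2 S p r \<le> tconorm_dist2 S p q + tconorm_dist2 S q r"
    if "p \<in> {0..1} \<times> {0..1}" "q \<in> {0..1} \<times> {0..1}" "r \<in> {0..1} \<times> {0..1}" for p q r
  proof -
    let ?a = "tconorm_dist S (fst p) (fst q)" and ?b = "tconorm_dist S (snd p) (snd q)"
    let ?a' = "tconorm_dist S (fst q) (fst r)" and ?b' = "tconorm_dist S (snd q) (snd r)"
    have "tconorm_dist2 S p r \<le> S (S ?a ?a') (S ?b ?b')"
      using that by (auto simp: tconorm_dist2_def simp del: atLeastAtMost_iff
          intro!: mono tconorm_dist_triangle closed dc)
    also have "\<dots> = S (S ?a ?b) (S ?a' ?b')"
      using assoc commute closed dc by metis
    also have "\<dots> \<le> S ?a ?b + S ?a' ?b'"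
      using sum_bound[OF assms] closed dc by blast
    finally show ?thesis using that by (simp add: tconorm_dist2_def)
  qed
qed

end

end

theory Submission
  imports Defs
begin

text \<open>Both maps are 1-Lipschitz. Indeed \<open>d(x, x') \<le> c\<close> means \<open>x' \<le> S(c, x)\<close> and \<open>x \<le> S(c, x')\<close>,
  so for \<open>a = d(x, x')\<close> and \<open>b = d(y, y')\<close> monotonicity and associativity give
  \<open>S(x', y') \<le> S(S(a, b), S(x, y))\<close>; and from \<open>S(x \<rightharpoonup> y, x) \<ge> y\<close> one obtains
  \<open>y' \<le> S(S(S(a, b), x \<rightharpoonup> y), x')\<close>, that is, \<open>x' \<rightharpoonup> y' \<le> S(S(a, b), x \<rightharpoonup> y)\<close> by adjunction.\<close>

context continuous_tconorm
begin

lemma left_commute: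
  assumes "x \<in> {0..1}" "y \<in> {0..1}" "z \<in> {0..1}"
  shows "S x (S y z) = S y (S x z)"
  using assms by (metis assoc commute)

lemma tconorm_perturb:
  assumes I: "x \<in> {0..1}" "y \<in> {0..1}" "x' \<in> {0..1}" "y' \<in> {0..1}" "a \<in> {0..1}" "b \<in> {0..1}"
    and le: "x' \<le> S a x" "y' \<le> S b y"
  shows "S x' y' \<le> S (S a b) (S x y)"
proof -
  have "S x' y' \<le> S (S a x) (S b y)"
    using I le by (intro mono closed)
  also have "\<dots> = S (S a b) (S x y)"
    \<comment> \<open>Both sides are reassociated to the right; the only exchange needed is that of
      \<open>x\<close> and \<open>b\<close>.\<close>
    using I by (simp only: assoc closed left_commute[of x b y])
  finally show ?thesis .
qed

text \<open>The two bounds point in opposite directions because the residuum is antitone in its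
  first argument and monotone in its second.\<close>

lemma residuum_perturb:
  assumes I: "x \<in> {0..1}" "y \<in> {0..1}" "x' \<in> {0..1}" "y' \<in> {0..1}" "a \<in> {0..1}" "b \<in> {0..1}"
    and le: "x \<le> S a x'" "y' \<le> S b y"
  shows "residuum S x' y' \<le> S (S a b) (residuum S x y)"
proof -
  let ?r = "residuum S x y"
  have r: "?r \<in> {0..1}" using I by (intro residuum_closed)
  have "y \<le> S ?r x" using residuum_iff[of x y ?r] I r by blast
  also have "S ?r x \<le> S ?r (S a x')" using I r le by (intro mono closed) auto
  also have "\<dots> = S a (S ?r x')" using I r by (intro left_commute)
  finally have "S b y \<le> S b (S a (S ?r x'))" using I r by (intro mono closed) auto
  also have "\<dots> = S (S (S a b) ?r) x'"
    using I r by (simp only: assoc closed left_commute[of b a])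
  finally have "y' \<le> S (S (S a b) ?r) x'" using le by linarith
  then show ?thesis using residuum_iff[of x' y' "S (S a b) ?r"] I r closed by blast
qed

text \<open>The distance itself is an admissible bound \<open>c\<close> in
  \<open>tconorm_dist_le_iff\<close>.\<close>

lemma tconorm_dist_perturb:
  assumes "x \<in> {0..1}" "y \<in> {0..1}"
  shows "y \<le> S (tconorm_dist S x y) x" "x \<le> S (tconorm_dist S x y) y"
  using tconorm_dist_le_iff[OF assms tconorm_dist_closed] by blast+

text \<open>A bound on the distance amounts to two inequalities; each is an instance of
  \<open>tconorm_perturb\<close>, the second with primed and unprimed points exchanged.\<close>

lemma tconorm_nonexpansive:
  assumes I: "x \<in> {0..1}" "y \<in> {0..1}" "x' \<in> {0..1}" "y' \<in> {0..1}"
  shows "tconorm_dist S (S x y) (S x' y') \<le> S (tconorm_dist S x x') (tconorm_dist S y y')"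
  using I by (intro tconorm_dist_le_iff[THEN iffD2] conjI tconorm_perturb tconorm_dist_perturb
      tconorm_dist_closed closed)

lemma residuum_nonexpansive:
  assumes I: "x \<in> {0..1}" "y \<in> {0..1}" "x' \<in> {0..1}" "y' \<in> {0..1}"
  shows "tconorm_dist S (residuum S x y) (residuum S x' y')
         \<le> S (tconorm_dist S x x') (tconorm_dist S y y')"
  using I by (intro tconorm_dist_le_iff[THEN iffD2] conjI residuum_perturb tconorm_dist_perturb
      tconorm_dist_closed closed residuum_closed)

text \<open>The bound in \<open>nonexp\<close> is exactly \<open>tconorm_dist2\<close>, so
  \<open>f\<close> is 1-Lipschitz; \<open>weaker\<close> turns the triangle inequality for
  \<open>S\<close> into the additive one, making both distances metrics.\<close>

lemma continuous_map_nonexpansive: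
  assumes weaker: "weaker_tconorm S lukasiewicz_tconorm"
    and closed_f: "\<And>x y. \<lbrakk>x \<in> {0..1}; y \<in> {0..1}\<rbrakk> \<Longrightarrow> f x y \<in> {0..1}"
    and nonexp: "\<And>x y x' y'. \<lbrakk>x \<in> {0..1}; y \<in> {0..1}; x' \<in> {0..1}; y' \<in> {0..1}\<rbrakk> \<Longrightarrow>
      tconorm_dist S (f x y) (f x' y') \<le> S (tconorm_dist S x x') (tconorm_dist S y y')"
  shows "continuous_map
           (Metric_space.mtopology ({0..1} \<times> {0..1}) (tconorm_dist2 S))
           (Metric_space.mtopology {0..1} (tconorm_dist S))
           (\<lambda>(x, y). f x y)"
proof -
  let ?f = "\<lambda>(x, y). f x y"
  have "tconorm_dist S (?f p) (?f q) \<le> tconorm_dist2 S p q"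
    if "p \<in> {0..1} \<times> {0..1}" "q \<in> {0..1} \<times> {0..1}" for p q
    using that nonexp by (auto simp: tconorm_dist2_def simp del: atLeastAtMost_iff)
  moreover have "?f ` ({0..1} \<times> {0..1}) \<subseteq> {0..1}"
    using closed_f by (auto simp del: atLeastAtMost_iff)
  ultimately show ?thesis
    unfolding Metric_space.metric_continuous_map[OF Metric_space_tconorm_dist2[OF weaker]
        Metric_space_tconorm_dist[OF weaker]]
    \<comment> \<open>In the epsilon-delta criterion, delta = epsilon works.\<close>
    by (meson le_less_trans)
qed

end

theorem theorem6p4:
  fixes S :: "real \<Rightarrow> real \<Rightarrow> real"
  assumes "continuous_tconorm S"
    and "weaker_tconorm S lukasiewicz_tconorm"
  shows "continuous_map
           (Metric_space.mtopology ({0..1} \<times> {0..1}) (tconorm_dist2 S))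
           (Metric_space.mtopology {0..1} (tconorm_dist S))
           (\<lambda>(x, y). S x y) \<and>
         continuous_map
           (Metric_space.mtopology ({0..1} \<times> {0..1}) (tconorm_dist2 S))
           (Metric_space.mtopology {0..1} (tconorm_dist S))
           (\<lambda>(x, y). residuum S x y)"
proof -
  interpret continuous_tconorm S by fact
  show ?thesis
    using continuous_map_nonexpansive[OF assms(2) closed tconorm_nonexpansive]
      continuous_map_nonexpansive[OF assms(2) residuum_closed residuum_nonexpansive]
    by blast
qed

end
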